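(* Let $r$ be a given line. There exist two lines $h,x$, both medial with respect to $r$, which are commensurable in square only and for which the rectangle $hx$ is a rational area with respect to $r$.
   Context: Lines (straight-line segments) are represented by positive real numbers, and areas of rectangles by products. Two lines (or two areas) are commensurable if their quotient is a rational number, and incommensurable otherwise. Two lines are commensurable in square only if their squares are commensurable but the lines themselves are incommensurable. Fix a line $r$. A line $a$ is rational (with respect to $r$) if $a^2,r^2$ are commensurable; an area is rational if it is commensurable with $r^2$. A line $m$ is medial (with respect to $r$) if there are rational lines $a,b$, incommensurable with each other, such that $m^2=ab$. *)

theory Defs
  imports Complex_Main
begin

(* Lines and areas are both positive reals, an area being a product of two lines.
   commensurable does not itself test positivity (its negation is used as
   incommensurability); it is only ever applied to positive arguments. *)
definition commensurable :: "real \<Rightarrow> real \<Rightarrow> bool" where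
  "commensurable p q \<longleftrightarrow> p / q \<in> \<rat>"

definition commensurable_in_square_only :: "real \<Rightarrow> real \<Rightarrow> bool" where
  "commensurable_in_square_only a b \<longleftrightarrow> commensurable (a\<^sup>2) (b\<^sup>2) \<and> \<not> commensurable a b"

(* A rational line need not be a rational multiple of r: only its square has to be
   commensurable with the square of r. *)
definition rational_line :: "real \<Rightarrow> real \<Rightarrow> bool" where
  "rational_line r a \<longleftrightarrow> 0 < a \<and> commensurable (a\<^sup>2) (r\<^sup>2)"

definition rational_area :: "real \<Rightarrow> real \<Rightarrow> bool" where
  "rational_area r A \<longleftrightarrow> 0 < A \<and> commensurable A (r\<^sup>2)"

definition medial :: "real \<Rightarrow> real \<Rightarrow> bool" where
  "medial r m \<longleftrightarrow> 0 < m \<and>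
     (\<exists>a b. rational_line r a \<and> rational_line r b \<and> \<not> commensurable a b \<and> m\<^sup>2 = a * b)"

end

theory Submission
  imports Defs "HOL-Computational_Algebra.Polynomial"
begin

text \<open>
  Start from two rational lines \<open>a\<close>, \<open>b\<close> that are incommensurable, such as \<open>r\<close> and
  \<open>r\<surd>2\<close>. Let \<open>h\<close> be their mean proportional, and let \<open>x\<close> be the fourth proportional
  with \<open>a : b = h : x\<close>. The ratio \<open>h : x\<close> equals \<open>a : b\<close>, so \<open>h\<close> and \<open>x\<close> are
  commensurable in square only because \<open>a\<close> and \<open>b\<close> are. The square on \<open>h\<close> is \<open>ab\<close>, and
  \<open>hx = h\<^sup>2b/a = b\<^sup>2\<close> is a rational area. Finally \<open>x\<close> is medial because
  \<open>x\<^sup>2 = b\<cdot>(b\<^sup>2/a)\<close>, where \<open>b\<^sup>2/a\<close> continues the proportion \<open>a : b = b : b\<^sup>2/a\<close> and is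
  therefore again rational and incommensurable with \<open>b\<close>.
\<close>

text \<open>
  On squares the proportion \<open>a : b = b : c\<close> reads \<open>c\<^sup>2 = (b\<^sup>2)\<^sup>2/a\<^sup>2\<close>; so, measured by \<open>r\<^sup>2\<close>,
  the square on \<open>c\<close> is a quotient of rational numbers even when \<open>c\<close> itself is not a
  rational multiple of \<open>r\<close>.
\<close>

lemma rational_line_third_proportional:
  assumes "0 < r" "rational_line r a" "rational_line r b"
  shows "rational_line r (b\<^sup>2 / a)"
proof -
  have "(b\<^sup>2 / a)\<^sup>2 / r\<^sup>2 = (b\<^sup>2 / r\<^sup>2)\<^sup>2 / (a\<^sup>2 / r\<^sup>2)"
    using assms(1) by (simp add: field_simps power2_eq_square)
  then show ?thesis
    using assms unfolding rational_line_def commensurable_def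
    by (metis Rats_divide Rats_power zero_less_divide_iff zero_less_power)
qed

lemma medial_pair_containing_rational_area:
  assumes r: "0 < r" and a: "rational_line r a" and b: "rational_line r b"
    and incomm: "\<not> commensurable a b"
  defines "h \<equiv> sqrt (a * b)" and "x \<equiv> sqrt (a * b) * b / a"
  shows "medial r h" "medial r x" "commensurable_in_square_only h x"
    "rational_area r (h * x)"
proof -
  have pos: "0 < a" "0 < b" using a b by (auto simp: rational_line_def)
  have h_pos: "0 < h" and h_sq: "h\<^sup>2 = a * b" using pos by (auto simp: h_def)
  have x_eq: "x = h * b / a" by (simp add: x_def h_def)
  have x_pos: "0 < x" using h_pos pos by (simp add: x_eq)
  have ratio: "h / x = a / b" using h_pos pos by (simp add: x_eq)
  show "medial r h"
    using h_pos h_sq a b incomm by (auto simp: medial_def)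
  have "x\<^sup>2 = b * (b\<^sup>2 / a)"
    using pos by (simp add: x_eq power_divide power_mult_distrib h_sq)
      (simp add: field_simps power2_eq_square)
  moreover have "b / (b\<^sup>2 / a) = a / b"
    using pos by (simp add: power2_eq_square)
  then have "\<not> commensurable b (b\<^sup>2 / a)"
    using incomm by (simp add: commensurable_def)
  ultimately show "medial r x"
    using x_pos b rational_line_third_proportional[OF r a b]
    unfolding medial_def by blast
  have "h\<^sup>2 / x\<^sup>2 = (a\<^sup>2 / r\<^sup>2) / (b\<^sup>2 / r\<^sup>2)"
    using ratio r by (simp flip: power_divide)
  then have "commensurable (h\<^sup>2) (x\<^sup>2)"
    using a b unfolding rational_line_def commensurable_def by (metis Rats_divide)
  then show "commensurable_in_square_only h x"
    using ratio incomm by (simp add: commensurable_in_square_only_def commensurable_def)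
  have "h * x = h\<^sup>2 * b / a" by (simp add: x_eq power2_eq_square)
  also have "\<dots> = b\<^sup>2" unfolding h_sq using pos by (simp add: power2_eq_square)
  finally show "rational_area r (h * x)"
    using pos b by (simp add: rational_area_def rational_line_def)
qed

theorem propositionX27:
  fixes r :: real
  assumes "0 < r"
  shows "\<exists>h x. 0 < h \<and> 0 < x \<and> medial r h \<and> medial r x \<and>
           commensurable_in_square_only h x \<and> rational_area r (h * x)"
proof -
  have "sqrt 2 \<notin> \<rat>"
  proof
    assume "sqrt 2 \<in> \<rat>"
    \<comment> \<open>A rational algebraic integer is an integer, but \<open>1 < sqrt 2 < 2\<close>.\<close>
    then have "sqrt 2 \<in> \<int>"
      by (intro rational_algebraic_int_is_int algebraic_int_sqrt) simp_all
    then obtain k :: int where k: "sqrt 2 = of_int k" by (elim Ints_cases)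
    have "1 < sqrt 2" "sqrt 2 < 2" using sqrt2_less_2 by simp_all
    then show False using k by simp
  qed
  moreover have "r * sqrt 2 / r = sqrt 2" using assms by simp
  ultimately have "\<not> commensurable (r * sqrt 2) r"
    by (simp add: commensurable_def)
  moreover have "rational_line r (r * sqrt 2)" "rational_line r r"
    using assms by (simp_all add: rational_line_def commensurable_def power_mult_distrib)
  ultimately show ?thesis
    using medial_pair_containing_rational_area[OF assms] by (metis medial_def)
qed

end
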